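(* For any positive integer $n$, the multivariate polynomial of Stirling permutations $$\sum_{\pi\in\mathcal{Q}_n}\ \prod_{i\in P(\pi)}x_{\pi_i}\prod_{j\in FA(\pi)}y_{\pi_{j+1}}$$ is real stable over the variables $\mathbf{x}=(x_1,\dots,x_n)$ and $\mathbf{y}=(y_1,\dots,y_n)$.
   Context: A polynomial $f\in\mathbb{R}[z_1,\dots,z_m]$ is (real) stable if either $f$ is identically zero or $f(z_1,\dots,z_m)\neq 0$ whenever all $z_i\in\mathbb{C}$ have positive imaginary part. $\mathcal{Q}_n$ is the set of Stirling permutations on the multiset $\{1,1,2,2,\dots,n,n\}$: permutations $\pi=\pi_1\cdots\pi_{2n}$ of this multiset such that, for all $1\le i<k<j\le 2n$, $\pi_i=\pi_j$ implies $\pi_k>\pi_i$. By convention $\pi_0=\pi_{2n+1}=0$. $P(\pi)=\{i:\ \pi_i=\pi_{i+1}\}$ is the set of plateaux of $\pi$, and $$FA(\pi)=\{i:\ 0\le i<2n,\ \pi_i<\pi_{i+1},\ \text{and } \pi_j\ne\pi_i\text{ for all }1\le j<i\}.$$ *)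

theory Defs
  imports Complex_Main "HOL-Library.Multiset" "HOL-Library.Poly_Mapping"
begin

section \<open>Real stable multivariate polynomials\<close>

text \<open>
  A polynomial is a finitely supported map from monomials to coefficients, a monomial a finitely
  supported map from variables to exponents; ring operations are those of
  \<^theory>\<open>HOL-Library.Poly_Mapping\<close>.
\<close>

type_synonym ('v, 'a) mpoly = "('v \<Rightarrow>\<^sub>0 nat) \<Rightarrow>\<^sub>0 'a"

definition Var :: "'v \<Rightarrow> ('v, 'a::zero_neq_one) mpoly" where
  "Var v = Poly_Mapping.single (Poly_Mapping.single v 1) 1"

definition polys_over :: "'v set \<Rightarrow> ('v, 'a::zero) mpoly set" where
  "polys_over V = {p. \<forall>m \<in> Poly_Mapping.keys p. Poly_Mapping.keys m \<subseteq> V}"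

definition ceval :: "('v \<Rightarrow> complex) \<Rightarrow> ('v, real) mpoly \<Rightarrow> complex" where
  "ceval z p = (\<Sum>m \<in> Poly_Mapping.keys p.
     complex_of_real (Poly_Mapping.lookup p m) *
     (\<Prod>v \<in> Poly_Mapping.keys m. z v ^ Poly_Mapping.lookup m v))"

definition real_stable :: "'v set \<Rightarrow> ('v, real) mpoly \<Rightarrow> bool" where
  "real_stable V p \<longleftrightarrow>
     p \<in> polys_over V \<and>
     (p = 0 \<or> (\<forall>z. (\<forall>v\<in>V. Im (z v) > 0) \<longrightarrow> ceval z p \<noteq> 0))"


section \<open>Stirling permutations\<close>

text \<open>
  Words are lists read with positions starting at 1. Positions 0 and \<open>length \<pi> + 1\<close> carry the
  conventional boundary letter 0.
\<close>

definition letter :: "nat list \<Rightarrow> nat \<Rightarrow> nat" where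
  "letter \<pi> i = (if 1 \<le> i \<and> i \<le> length \<pi> then \<pi> ! (i - 1) else 0)"

definition stirling_perms :: "nat \<Rightarrow> nat list set" where
  "stirling_perms n =
     {\<pi>. mset \<pi> = repeat_mset 2 (mset_set {1..n}) \<and>
         (\<forall>i k j. 1 \<le> i \<and> i < k \<and> k < j \<and> j \<le> 2 * n \<and> letter \<pi> i = letter \<pi> j
            \<longrightarrow> letter \<pi> k > letter \<pi> i)}"

lemma finite_stirling_perms: "finite (stirling_perms n)"
proof -
  obtain xs where "mset xs = repeat_mset 2 (mset_set {1..n})"
    using ex_mset by blast
  then have "stirling_perms n \<subseteq> {\<pi>. mset \<pi> = mset xs}"
    by (auto simp: stirling_perms_def)
  then show ?thesis
    by (rule finite_subset) (rule mset_eq_finite)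
qed

lemma length_stirling_perms:
  assumes "\<pi> \<in> stirling_perms n"
  shows "length \<pi> = 2 * n"
proof -
  have "mset \<pi> = repeat_mset 2 (mset_set {1..n})"
    using assms by (simp add: stirling_perms_def)
  then have "size (mset \<pi>) = size (repeat_mset 2 (mset_set {1..n}))"
    by (rule arg_cong)
  then show ?thesis by simp
qed

definition plateaux :: "nat list \<Rightarrow> nat set" where
  "plateaux \<pi> = {i. 1 \<le> i \<and> i \<le> length \<pi> \<and> letter \<pi> i = letter \<pi> (i + 1)}"

definition first_ascents :: "nat list \<Rightarrow> nat set" where
  "first_ascents \<pi> =
     {i. i < length \<pi> \<and> letter \<pi> i < letter \<pi> (i + 1) \<and>
         (\<forall>j. 1 \<le> j \<and> j < i \<longrightarrow> letter \<pi> j \<noteq> letter \<pi> i)}"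

datatype xy_var = XVar nat | YVar nat

definition stirling_poly :: "nat \<Rightarrow> (xy_var, real) mpoly" where
  "stirling_poly n =
     (\<Sum>\<pi> \<in> stirling_perms n.
        (\<Prod>i \<in> plateaux \<pi>. Var (XVar (letter \<pi> i))) *
        (\<Prod>j \<in> first_ascents \<pi>. Var (YVar (letter \<pi> (j + 1)))))"

end

theory Submission
  imports Defs "HOL-Computational_Algebra.Fundamental_Theorem_Algebra"
begin

text \<open>
  Removing the two adjacent copies of the largest letter exhibits the words of order \<open>m + 1\<close> as the
  words \<open>\<pi>\<close> of order \<open>m\<close> with \<open>m + 1, m + 1\<close> inserted in one of the \<open>2 m + 1\<close> gaps. The \<open>m + 1\<close> gaps
  that follow a first occurrence (or the initial 0) are exactly the plateaux and first ascents of
  \<open>\<pi>\<close>, and inserting there replaces the variable of the gap by \<open>x\<^sub>m\<^sub>+\<^sub>1 y\<^sub>m\<^sub>+\<^sub>1\<close>; inserting in one of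
  the other \<open>m\<close> gaps only contributes the factor \<open>x\<^sub>m\<^sub>+\<^sub>1\<close>. Hence, with \<open>D\<close> the sum of all partial
  derivatives, \<open>S\<^sub>m\<^sub>+\<^sub>1 = x\<^sub>m\<^sub>+\<^sub>1 (m S\<^sub>m + y\<^sub>m\<^sub>+\<^sub>1 D S\<^sub>m)\<close>. If \<open>S\<^sub>m\<close> is stable then \<open>t \<mapsto> S\<^sub>m (z + t)\<close> has all
  its roots in the open lower half-plane, so \<open>D S\<^sub>m / S\<^sub>m\<close>, its logarithmic derivative at 0, has
  nonpositive imaginary part and cannot equal \<open>- m / y\<^sub>m\<^sub>+\<^sub>1\<close>.
\<close>

section \<open>Evaluation of sums of monomials\<close>

text \<open>Monomials outside the support have coefficient 0. Enlarging the index set lets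
  polynomials with different supports be summed over a common one.\<close>

lemma ceval_superset:
  assumes "finite A" "Poly_Mapping.keys p \<subseteq> A"
  shows "ceval z p = (\<Sum>m\<in>A. complex_of_real (Poly_Mapping.lookup p m) *
     (\<Prod>v \<in> Poly_Mapping.keys m. z v ^ Poly_Mapping.lookup m v))"
  unfolding ceval_def using assms
  by (intro sum.mono_neutral_left) (auto simp: in_keys_iff)

lemma ceval_zero [simp]: "ceval z 0 = 0"
  by (simp add: ceval_def)

lemma ceval_add: "ceval z (p + q) = ceval z p + ceval z q"
proof -
  let ?A = "Poly_Mapping.keys p \<union> Poly_Mapping.keys q"
  have "Poly_Mapping.keys (p + q) \<subseteq> ?A"
    by (rule Poly_Mapping.keys_add)
  then show ?thesis
    by (simp add: ceval_superset[of ?A] lookup_add algebra_simps sum.distrib)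
qed

lemma ceval_sum: "ceval z (\<Sum>i\<in>I. f i) = (\<Sum>i\<in>I. ceval z (f i))"
  by (induction I rule: infinite_finite_induct) (auto simp: ceval_add)

lemma prod_Var:
  "(\<Prod>i\<in>I. Var (f i)) = Poly_Mapping.single (\<Sum>i\<in>I. Poly_Mapping.single (f i) 1) (1::'a::comm_semiring_1)"
  by (induction I rule: infinite_finite_induct) (auto simp: Var_def mult_single)

lemma prod_power_superset:
  fixes z :: "'v \<Rightarrow> complex"
  assumes "finite A" "Poly_Mapping.keys m \<subseteq> A"
  shows "(\<Prod>v \<in> Poly_Mapping.keys m. z v ^ Poly_Mapping.lookup m v)
    = (\<Prod>v\<in>A. z v ^ Poly_Mapping.lookup m v)"
  using assms by (intro prod.mono_neutral_left) (auto simp: in_keys_iff)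

text \<open>The map \<open>f\<close> may hit a variable several times, so exponents accumulate. The
  induction therefore computes over a set \<open>?A\<close> containing all variables involved, where
  exponents add factor by factor.\<close>

lemma ceval_prod_Var: "ceval z (\<Prod>i\<in>I. Var (f i)) = (\<Prod>i\<in>I. z (f i))"
proof -
  let ?m = "\<lambda>I. \<Sum>i\<in>I. Poly_Mapping.single (f i) (1::nat)"
  have "(\<Prod>v \<in> Poly_Mapping.keys (?m I). z v ^ Poly_Mapping.lookup (?m I) v) = (\<Prod>i\<in>I. z (f i))"
  proof (induction I rule: infinite_finite_induct)
    case (insert i I)
    let ?A = "insert (f i) (Poly_Mapping.keys (?m I))"
    have "Poly_Mapping.keys (?m (insert i I)) \<subseteq> ?A"
      using insert.hyps Poly_Mapping.keys_add[of "Poly_Mapping.single (f i) 1" "?m I"] by auto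
    then have "(\<Prod>v \<in> Poly_Mapping.keys (?m (insert i I)). z v ^ Poly_Mapping.lookup (?m (insert i I)) v)
      = (\<Prod>v\<in>?A. z v ^ Poly_Mapping.lookup (?m (insert i I)) v)"
      by (intro prod_power_superset) auto
    also have "\<dots> = (\<Prod>v\<in>?A. z v ^ Poly_Mapping.lookup (Poly_Mapping.single (f i) 1) v)
        * (\<Prod>v\<in>?A. z v ^ Poly_Mapping.lookup (?m I) v)"
      unfolding sum.insert[OF insert.hyps] by (simp only: lookup_add power_add prod.distrib)
    also have "(\<Prod>v\<in>?A. z v ^ Poly_Mapping.lookup (Poly_Mapping.single (f i) 1) v) = z (f i)"
      by (subst prod_power_superset[symmetric]) auto
    also have "(\<Prod>v\<in>?A. z v ^ Poly_Mapping.lookup (?m I) v) = (\<Prod>i\<in>I. z (f i))"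
      using insert.IH by (subst prod_power_superset[symmetric]) auto
    finally show ?case
      using insert.hyps by simp
  qed auto
  then show ?thesis
    by (simp add: prod_Var ceval_def)
qed

section \<open>Variables occurring in sums and products\<close>

lemma polys_over_sum:
  "(\<And>i. i \<in> I \<Longrightarrow> p i \<in> polys_over V) \<Longrightarrow> (\<Sum>i\<in>I. p i) \<in> polys_over V"
proof (induction I rule: infinite_finite_induct)
  case (insert i I)
  then show ?case
    using Poly_Mapping.keys_add[of "p i" "sum p I"] by (fastforce simp: polys_over_def)
qed (auto simp: polys_over_def)

lemma polys_over_prod_Var:
  assumes "\<And>i. i \<in> I \<Longrightarrow> f i \<in> V"
  shows "(\<Prod>i\<in>I. Var (f i) :: ('v, 'a::comm_semiring_1) mpoly) \<in> polys_over V"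
proof -
  have "Poly_Mapping.keys (\<Sum>i\<in>I. Poly_Mapping.single (f i) (1::nat)) \<subseteq> V"
    using assms
  proof (induction I rule: infinite_finite_induct)
    case (insert i I)
    then show ?case
      using Poly_Mapping.keys_add[of "Poly_Mapping.single (f i) 1" "\<Sum>i\<in>I. Poly_Mapping.single (f i) (1::nat)"]
      by auto
  qed auto
  then show ?thesis
    by (auto simp: polys_over_def prod_Var)
qed


section \<open>Logarithmic derivatives\<close>

text \<open>The logarithmic derivative at 0 is the sum of \<open>- 1 / r\<close> over the roots
  \<open>r\<close> with multiplicity. Every root has \<open>Im r < 0\<close>, and
  \<open>- 1 / r\<close> has imaginary part \<open>Im r / (cmod r)\<^sup>2\<close>. The induction
  splits off one root at a time.\<close>

lemma Im_log_deriv_nonpos: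
  fixes p :: "complex poly"
  assumes "\<And>t. Im t \<ge> 0 \<Longrightarrow> poly p t \<noteq> 0"
  shows "Im (poly (pderiv p) 0 / poly p 0) \<le> 0"
  using assms
proof (induction "degree p" arbitrary: p)
  case 0
  then obtain a where "p = [:a:]"
    by (metis degree_eq_zeroE)
  then show ?case by simp
next
  case (Suc d)
  have "\<not> constant (poly p)"
    using Suc.hyps(2) by (simp add: constant_degree)
  then obtain r where r: "poly p r = 0"
    using fundamental_theorem_of_algebra by blast
  then obtain q where q: "p = [:-r, 1:] * q"
    by (auto simp: poly_eq_0_iff_dvd)
  have "q \<noteq> 0"
    using Suc.hyps(2) q by auto
  then have "degree p = Suc (degree q)"
    unfolding q by (subst degree_mult_eq) auto
  then have IH: "Im (poly (pderiv q) 0 / poly q 0) \<le> 0"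
    using Suc.hyps Suc.prems q by (intro Suc.hyps(1)) auto
  have "Im r < 0"
    using Suc.prems r by force
  moreover have "r \<noteq> 0" "poly q 0 \<noteq> 0"
    using \<open>Im r < 0\<close> Suc.prems[of 0] q by auto
  then have "poly (pderiv p) 0 / poly p 0 = 1 / (- r) + poly (pderiv q) 0 / poly q 0"
    unfolding q by (simp add: pderiv_mult pderiv_pCons divide_simps del: mult_pCons_left)
  moreover have "Im (1 / (- r)) \<le> 0"
    using \<open>Im r < 0\<close> by (simp add: Im_divide divide_nonpos_nonneg)
  ultimately show ?case
    using IH by simp
qed

text \<open>If the expression vanished, the logarithmic derivative at 0 would be
  \<open>- c / y\<close>, which lies in the open upper half-plane.\<close>

lemma add_mult_log_deriv_nonzero:
  fixes p :: "complex poly"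
  assumes "\<And>t. Im t \<ge> 0 \<Longrightarrow> poly p t \<noteq> 0" and "c > 0" "Im y > 0"
  shows "of_real c * poly p 0 + y * poly (pderiv p) 0 \<noteq> 0"
proof
  assume eq: "of_real c * poly p 0 + y * poly (pderiv p) 0 = 0"
  have "poly p 0 \<noteq> 0" "y \<noteq> 0"
    using assms by auto
  then have "poly (pderiv p) 0 / poly p 0 = of_real (- c) / y"
    using eq by (simp add: field_simps add_eq_0_iff)
  moreover have "Im (of_real (- c) / y) = c * Im y / (cmod y)\<^sup>2"
    by (simp add: Im_divide cmod_power2)
  moreover have "c * Im y / (cmod y)\<^sup>2 > 0"
    using assms \<open>y \<noteq> 0\<close> by simp
  ultimately show False
    using Im_log_deriv_nonpos[OF assms(1)] by simp
qed


section \<open>Insertion of the largest letter\<close>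

text \<open>Gap \<open>i\<close> lies between positions \<open>i\<close> and \<open>i + 1\<close>,
  so the new copies occupy positions \<open>i + 1\<close> and \<open>i + 2\<close>; gap 0 is in
  front of the word.\<close>

definition insert_pair :: "nat \<Rightarrow> nat list \<Rightarrow> nat \<Rightarrow> nat list" where
  "insert_pair a \<pi> i = take i \<pi> @ a # a # drop i \<pi>"

lemma letter_insert_pair:
  assumes "i \<le> length \<pi>"
  shows "letter (insert_pair a \<pi> i) k =
    (if k \<le> i then letter \<pi> k else if k \<le> i + 2 then a else letter \<pi> (k - 2))"
  using assms
  by (auto simp: letter_def insert_pair_def nth_append nth_Cons' min_def)

lemma length_insert_pair [simp]: "i \<le> length \<pi> \<Longrightarrow> length (insert_pair a \<pi> i) = length \<pi> + 2"
  by (simp add: insert_pair_def)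

lemma mset_insert_pair: "mset (insert_pair a \<pi> i) = mset \<pi> + {#a, a#}"
proof -
  have "mset (take i \<pi>) + mset (drop i \<pi>) = mset \<pi>"
    by (metis append_take_drop_id mset_append)
  then show ?thesis
    by (simp add: insert_pair_def)
qed

text \<open>Deleting all copies of \<open>a\<close> recovers the word, and the length of the prefix
  before the first \<open>a\<close> recovers the gap.\<close>

lemma insert_pair_inject:
  assumes "a \<notin> set \<pi>" "a \<notin> set \<rho>" "i \<le> length \<pi>" "j \<le> length \<rho>"
    and eq: "insert_pair a \<pi> i = insert_pair a \<rho> j"
  shows "\<pi> = \<rho> \<and> i = j"
proof -
  have *: "filter (\<lambda>x. x \<noteq> a) (insert_pair a \<pi> i) = \<pi>
      \<and> takeWhile (\<lambda>x. x \<noteq> a) (insert_pair a \<pi> i) = take i \<pi>" if "a \<notin> set \<pi>" for \<pi> i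
  proof -
    have "\<forall>x\<in>set (take i \<pi>). x \<noteq> a" "\<forall>x\<in>set (drop i \<pi>). x \<noteq> a"
      using that by (auto dest: in_set_takeD in_set_dropD)
    then show ?thesis
      by (simp add: insert_pair_def takeWhile_append2)
  qed
  have "\<pi> = \<rho>" "take i \<pi> = take j \<rho>"
    using *[OF assms(1), of i] *[OF assms(2), of j] eq by auto
  then show ?thesis
    using assms(3,4) by (metis length_take min.absorb2)
qed

lemma repeat_mset_Suc_interval:
  "repeat_mset 2 (mset_set {1..Suc m}) = repeat_mset 2 (mset_set {1..m}) + {#Suc m, Suc m#}"
  by (simp add: atLeastAtMostSuc_conv numeral_2_eq_2)

section \<open>Letters of a Stirling permutation\<close>

lemma set_stirling_perms:
  assumes "\<pi> \<in> stirling_perms n"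
  shows "set \<pi> = {1..n}"
proof -
  have "count (mset \<pi>) a = 2 * count (mset_set {1..n}) a" for a
    using assms by (simp add: stirling_perms_def)
  then have "a \<in># mset \<pi> \<longleftrightarrow> a \<in># mset_set {1..n}" for a
    by (simp only: count_greater_zero_iff[symmetric]) simp
  then have "set_mset (mset \<pi>) = set_mset (mset_set {1..n})"
    by blast
  then show ?thesis
    by simp
qed

lemma letter_mem:
  assumes "\<pi> \<in> stirling_perms n" "1 \<le> i" "i \<le> 2 * n"
  shows "letter \<pi> i \<in> {1..n}"
proof -
  have "letter \<pi> i \<in> set \<pi>"
    using assms length_stirling_perms[OF assms(1)] by (auto simp: letter_def)
  then show ?thesis
    using set_stirling_perms[OF assms(1)] by simp
qed

lemma letter_le:
  assumes "\<pi> \<in> stirling_perms n"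
  shows "letter \<pi> i \<le> n"
  using letter_mem[OF assms, of i] length_stirling_perms[OF assms] by (auto simp: letter_def)

lemma stirling_between:
  assumes "\<pi> \<in> stirling_perms n" "1 \<le> i" "i < k" "k < j" "j \<le> 2 * n" "letter \<pi> i = letter \<pi> j"
  shows "letter \<pi> i < letter \<pi> k"
  using assms by (auto simp: stirling_perms_def)

lemma stirling_permsI:
  assumes "mset \<pi> = repeat_mset 2 (mset_set {1..n})"
    and "\<And>i k j. \<lbrakk>1 \<le> i; i < k; k < j; j \<le> 2 * n; letter \<pi> i = letter \<pi> j\<rbrakk> \<Longrightarrow> letter \<pi> i < letter \<pi> k"
  shows "\<pi> \<in> stirling_perms n"
  unfolding stirling_perms_def mem_Collect_eq using assms by metis

text \<open>Two equal letters are either both new or both old. The new ones are adjacent with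
  nothing between them; between two old ones stands either an old letter, as before, or
  \<open>Suc m\<close>, which exceeds all old letters.\<close>

lemma insert_pair_in_stirling_perms:
  assumes \<pi>: "\<pi> \<in> stirling_perms m" and i: "i \<le> 2 * m"
  shows "insert_pair (Suc m) \<pi> i \<in> stirling_perms (Suc m)"
proof -
  let ?\<sigma> = "insert_pair (Suc m) \<pi> i"
  \<comment> \<open>This maps positions of old letters back to \<open>\<pi>\<close>; off
    \<open>i + 1\<close> and \<open>i + 2\<close> it is strictly increasing.\<close>
  let ?g = "\<lambda>k. if k \<le> i then k else k - 2"
  have len: "length \<pi> = 2 * m"
    by (rule length_stirling_perms[OF \<pi>])
  have L: "letter ?\<sigma> k = (if k \<in> {i + 1, i + 2} then Suc m else letter \<pi> (?g k))" for k
    using letter_insert_pair[of i \<pi> "Suc m" k] i len by auto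
  have nm: "letter \<pi> k \<noteq> Suc m" "letter \<pi> k < Suc m" for k
    using letter_le[OF \<pi>, of k] by auto
  have "letter ?\<sigma> a < letter ?\<sigma> k"
    if a: "1 \<le> a" "a < k" "k < b" "b \<le> 2 * Suc m" and eq: "letter ?\<sigma> a = letter ?\<sigma> b" for a k b
  proof (cases "a \<in> {i + 1, i + 2}")
    case True
    then have "b \<in> {i + 1, i + 2}"
      using eq nm by (auto simp: L split: if_splits)
    then show ?thesis
      using True a by auto
  next
    case False
    then have b: "b \<notin> {i + 1, i + 2}"
      using eq nm by (metis L)
    show ?thesis
    proof (cases "k \<in> {i + 1, i + 2}")
      case True
      then show ?thesis
        using False nm by (simp add: L)
    next
      case k: False
      have "letter \<pi> (?g a) < letter \<pi> (?g k)"
      proof (rule stirling_between[OF \<pi>])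
        show "1 \<le> ?g a" "?g a < ?g k" "?g k < ?g b" "?g b \<le> 2 * m"
          using a False b k i by auto
        show "letter \<pi> (?g a) = letter \<pi> (?g b)"
          using eq False b by (metis L)
      qed
      then show ?thesis
        using k False by (simp only: L if_False)
    qed
  qed
  moreover have "mset ?\<sigma> = repeat_mset 2 (mset_set {1..Suc m})"
    unfolding mset_insert_pair repeat_mset_Suc_interval using \<pi> by (simp add: stirling_perms_def)
  ultimately show ?thesis
    by (rule stirling_permsI[rotated])
qed

text \<open>A letter between the two copies of \<open>Suc m\<close> would have to exceed the
  maximum, so the copies are adjacent. Deleting them keeps the order of the remaining positions and
  with it the Stirling condition.\<close>

lemma stirling_perms_Suc_cases:
  assumes \<sigma>: "\<sigma> \<in> stirling_perms (Suc m)"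
  obtains \<pi> i where "\<pi> \<in> stirling_perms m" "i \<le> 2 * m" "\<sigma> = insert_pair (Suc m) \<pi> i"
proof -
  let ?n = "Suc m"
  have ms: "mset \<sigma> = repeat_mset 2 (mset_set {1..m}) + {#?n, ?n#}"
    using \<sigma> repeat_mset_Suc_interval[of m] by (simp only: stirling_perms_def mem_Collect_eq)
  then have "?n \<in># mset \<sigma>"
    by simp
  then obtain xs ys where s1: "\<sigma> = xs @ ?n # ys"
    by (metis set_mset_mset split_list)
  \<comment> \<open>With one copy of \<open>?n\<close> split off, a second one is still left, on one
    of the two sides.\<close>
  then have ms1: "mset xs + mset ys = repeat_mset 2 (mset_set {1..m}) + {#?n#}"
    using ms by simp
  have "\<exists>us vs ws. \<sigma> = us @ ?n # vs @ ?n # ws"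
  proof (cases "?n \<in> set ys")
    case True
    then show ?thesis
      using s1 by (metis split_list)
  next
    case False
    have "?n \<in># mset xs + mset ys"
      using ms1 by simp
    then have "?n \<in> set xs"
      using False by simp
    then show ?thesis
      using s1 by (metis split_list append.assoc append_Cons)
  qed
  then obtain us vs ws where s2: "\<sigma> = us @ ?n # vs @ ?n # ws"
    by blast
  have "vs = []"
  proof (rule ccontr)
    assume "vs \<noteq> []"
    let ?a = "length us + 1" and ?b = "length us + length vs + 2"
    have "letter \<sigma> ?a < letter \<sigma> (?a + 1)"
    proof (rule stirling_between[OF \<sigma>, of _ _ ?b])
      show "?a + 1 < ?b"
        using \<open>vs \<noteq> []\<close> by simp
      show "?b \<le> 2 * Suc m"
        using length_stirling_perms[OF \<sigma>] s2 by simp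
      show "letter \<sigma> ?a = letter \<sigma> ?b"
        by (simp add: s2 letter_def nth_append)
    qed auto
    moreover have "letter \<sigma> ?a = ?n"
      by (simp add: s2 letter_def nth_append)
    ultimately show False
      using letter_le[OF \<sigma>, of "?a + 1"] by simp
  qed
  define \<pi> i where "\<pi> = us @ ws" and "i = length us"
  have s3: "\<sigma> = insert_pair ?n \<pi> i"
    by (simp add: s2 \<open>vs = []\<close> \<pi>_def i_def insert_pair_def)
  have ms\<pi>: "mset \<pi> = repeat_mset 2 (mset_set {1..m})"
    using ms by (simp add: s3 mset_insert_pair)
  have len: "length \<pi> = 2 * m"
    using arg_cong[OF ms\<pi>, of size] by simp
  have i: "i \<le> 2 * m"
    using len by (simp add: \<pi>_def i_def)
  let ?h = "\<lambda>k. if k \<le> i then k else k + 2"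
  have L: "letter \<sigma> (?h k) = letter \<pi> k" for k
    using i len by (simp add: s3 letter_insert_pair)
  have "letter \<pi> a < letter \<pi> k"
    if "1 \<le> a" "a < k" "k < b" "b \<le> 2 * m" and eq: "letter \<pi> a = letter \<pi> b" for a k b
  proof -
    have "letter \<sigma> (?h a) < letter \<sigma> (?h k)"
    proof (rule stirling_between[OF \<sigma>, of _ _ "?h b"])
      show "letter \<sigma> (?h a) = letter \<sigma> (?h b)"
        unfolding L by (rule eq)
    qed (use that in auto)
    then show ?thesis
      unfolding L .
  qed
  then have "\<pi> \<in> stirling_perms m"
    by (rule stirling_permsI[OF ms\<pi>])
  then show thesis
    using that i s3 by blast
qed

lemma bij_betw_insert_pair:
  "bij_betw (\<lambda>(\<pi>, i). insert_pair (Suc m) \<pi> i) (stirling_perms m \<times> {..2 * m}) (stirling_perms (Suc m))"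
  unfolding bij_betw_def
proof
  show "inj_on (\<lambda>(\<pi>, i). insert_pair (Suc m) \<pi> i) (stirling_perms m \<times> {..2 * m})"
  proof -
    have "\<pi> = \<rho> \<and> i = j"
      if "\<pi> \<in> stirling_perms m" "\<rho> \<in> stirling_perms m" "i \<le> 2 * m" "j \<le> 2 * m"
        "insert_pair (Suc m) \<pi> i = insert_pair (Suc m) \<rho> j" for \<pi> \<rho> i j
      using that
      by (intro insert_pair_inject[of "Suc m"]) (auto simp: set_stirling_perms length_stirling_perms)
    then show ?thesis
      unfolding inj_on_def by force
  qed
  show "(\<lambda>(\<pi>, i). insert_pair (Suc m) \<pi> i) ` (stirling_perms m \<times> {..2 * m}) = stirling_perms (Suc m)"
    by (force elim: stirling_perms_Suc_cases intro: insert_pair_in_stirling_perms)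
qed


section \<open>First occurrences\<close>

definition firsts :: "nat list \<Rightarrow> nat set" where
  "firsts \<pi> = {i. i \<le> length \<pi> \<and> (\<forall>j. 1 \<le> j \<and> j < i \<longrightarrow> letter \<pi> j \<noteq> letter \<pi> i)}"

text \<open>The weight of a gap, chosen so that the products over plateaux and over first ascents
  merge into a single product over \<open>firsts\<close>.\<close>

definition gap_var :: "nat list \<Rightarrow> nat \<Rightarrow> xy_var" where
  "gap_var \<pi> i = (if letter \<pi> i = letter \<pi> (i + 1) then XVar (letter \<pi> i) else YVar (letter \<pi> (i + 1)))"

lemma finite_firsts [simp]: "finite (firsts \<pi>)"
  by (rule finite_subset[of _ "{..length \<pi>}"]) (auto simp: firsts_def)

text \<open>Each letter has exactly one first occurrence; the extra element is position 0, the
  conventional initial letter.\<close>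

lemma card_firsts: 
  assumes "0 \<notin> set \<pi>"
  shows "card (firsts \<pi>) = Suc (card (set \<pi>))"
proof -
  have "bij_betw (letter \<pi>) (firsts \<pi> - {0}) (set \<pi>)"
    unfolding bij_betw_def
  proof
    show "inj_on (letter \<pi>) (firsts \<pi> - {0})"
    proof (rule inj_onI)
      fix i j assume ij: "i \<in> firsts \<pi> - {0}" "j \<in> firsts \<pi> - {0}" and eq: "letter \<pi> i = letter \<pi> j"
      have "\<forall>k. 1 \<le> k \<and> k < i \<longrightarrow> letter \<pi> k \<noteq> letter \<pi> i"
        "\<forall>k. 1 \<le> k \<and> k < j \<longrightarrow> letter \<pi> k \<noteq> letter \<pi> j" "1 \<le> i" "1 \<le> j"
        using ij unfolding firsts_def by auto
      then show "i = j"
        using eq by (metis linorder_neqE_nat)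
    qed
    show "letter \<pi> ` (firsts \<pi> - {0}) = set \<pi>"
    proof
      show "letter \<pi> ` (firsts \<pi> - {0}) \<subseteq> set \<pi>"
        by (auto simp: firsts_def letter_def)
      show "set \<pi> \<subseteq> letter \<pi> ` (firsts \<pi> - {0})"
      proof
        fix a assume "a \<in> set \<pi>"
        then obtain k where k: "k < length \<pi>" "\<pi> ! k = a"
          by (auto simp: in_set_conv_nth)
        define l where "l = (LEAST i. 1 \<le> i \<and> letter \<pi> i = a)"
        have Suc_k: "1 \<le> Suc k \<and> letter \<pi> (Suc k) = a"
          using k by (simp add: letter_def)
        then have l: "1 \<le> l" "letter \<pi> l = a" "l \<le> Suc k"
          unfolding l_def by (metis (mono_tags, lifting) LeastI, metis (mono_tags, lifting) LeastI, rule Least_le)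
        have "letter \<pi> j \<noteq> letter \<pi> l" if "1 \<le> j" "j < l" for j
          using not_less_Least[of j "\<lambda>i. 1 \<le> i \<and> letter \<pi> i = a"] that l(2) by (simp add: l_def)
        then have "l \<in> firsts \<pi> - {0}"
          using k l by (simp add: firsts_def)
        then show "a \<in> letter \<pi> ` (firsts \<pi> - {0})"
          using l(2) by blast
      qed
    qed
  qed
  then have "card (firsts \<pi> - {0}) = card (set \<pi>)"
    by (rule bij_betw_same_card)
  moreover have "0 \<in> firsts \<pi>"
    by (simp add: firsts_def)
  ultimately show ?thesis
    by (metis card.remove finite_firsts)
qed

text \<open>Of the \<open>2 * m + 1\<close> gaps, \<open>m + 1\<close> follow a first occurrence or
  the initial 0. The remaining count is the coefficient \<open>m\<close> in the recurrence.\<close>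

lemma card_not_firsts:
  assumes "\<pi> \<in> stirling_perms m"
  shows "card ({..2 * m} - firsts \<pi>) = m"
proof -
  have "firsts \<pi> \<subseteq> {..2 * m}"
    using length_stirling_perms[OF assms] by (auto simp: firsts_def)
  moreover have "card (firsts \<pi>) = Suc m"
    using card_firsts[of \<pi>] set_stirling_perms[OF assms] by simp
  ultimately show ?thesis
    by (simp add: card_Diff_subset)
qed

text \<open>Every letter has multiplicity two and no copy precedes its first occurrence, so the
  other copy comes later.\<close>

lemma stirling_repeated:
  assumes \<pi>: "\<pi> \<in> stirling_perms n" and i: "1 \<le> i" "i \<le> 2 * n" "i \<in> firsts \<pi>"
  obtains j where "i < j" "j \<le> 2 * n" "letter \<pi> j = letter \<pi> i"
proof -
  have len: "length \<pi> = 2 * n"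
    by (rule length_stirling_perms[OF \<pi>])
  let ?a = "letter \<pi> i"
  have "\<pi> = take (i - 1) \<pi> @ ?a # drop i \<pi>"
    using i len id_take_nth_drop[of "i - 1" \<pi>] by (simp add: letter_def)
  then have "count (mset \<pi>) ?a = count (mset (take (i - 1) \<pi> @ ?a # drop i \<pi>)) ?a"
    by (rule arg_cong)
  also have "\<dots> = count (mset (take (i - 1) \<pi>)) ?a + 1 + count (mset (drop i \<pi>)) ?a"
    by simp
  finally have "count (mset \<pi>) ?a = count (mset (take (i - 1) \<pi>)) ?a + 1 + count (mset (drop i \<pi>)) ?a" .
  moreover have "count (mset \<pi>) ?a = 2"
    using \<pi> letter_mem[OF \<pi> i(1,2)] by (simp add: stirling_perms_def)
  moreover have "?a \<notin> set (take (i - 1) \<pi>)"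
  proof
    assume "?a \<in> set (take (i - 1) \<pi>)"
    then obtain k where "k < i - 1" "\<pi> ! k = ?a"
      by (auto simp: in_set_conv_nth)
    then have "letter \<pi> (Suc k) = ?a" "Suc k < i"
      using i len by (auto simp: letter_def)
    then show False
      using i by (auto simp: firsts_def)
  qed
  then have "count (mset (take (i - 1) \<pi>)) ?a = 0"
    by (simp add: count_eq_zero_iff)
  ultimately have "count (mset (drop i \<pi>)) ?a = 1"
    by linarith
  then have "?a \<in># mset (drop i \<pi>)"
    by (metis count_eq_zero_iff zero_neq_one)
  then obtain k where "k < length \<pi> - i" "\<pi> ! (i + k) = ?a"
    by (auto simp: in_set_conv_nth)
  then show thesis
    \<comment> \<open>List index \<open>i + k\<close> is position \<open>i + k + 1\<close>.\<close>
    using len by (intro that[of "i + k + 1"]) (auto simp: letter_def)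
qed

text \<open>Position \<open>i + 1\<close> either carries the second copy of the letter at
  \<open>i\<close> or lies strictly between the two copies, where letters are larger. For
  \<open>i = 0\<close> the left letter is 0.\<close>

lemma firsts_le:
  assumes \<pi>: "\<pi> \<in> stirling_perms n" and i: "i \<in> firsts \<pi>"
  shows "letter \<pi> i \<le> letter \<pi> (i + 1)"
proof (cases "i = 0")
  case True
  then show ?thesis by (simp add: letter_def)
next
  case False
  have "i \<le> 2 * n"
    using i length_stirling_perms[OF \<pi>] by (simp add: firsts_def)
  then obtain j where "i < j" "j \<le> 2 * n" "letter \<pi> j = letter \<pi> i"
    using stirling_repeated[OF \<pi> _ _ i] False by auto
  then show ?thesis
    using stirling_between[OF \<pi>, of i "i + 1" j] False by (cases "j = i + 1") auto
qed

text \<open>A first occurrence is never followed by a descent, which gives one inclusion.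
  Conversely, a copy before a plateau at \<open>i\<close> would put position \<open>i\<close>
  between two equal letters and force its letter to exceed itself. For the empty word
  \<open>firsts\<close> is \<open>{0}\<close> while the right-hand side is empty.\<close>

lemma firsts_eq_plateaux_Un_first_ascents:
  assumes \<pi>: "\<pi> \<in> stirling_perms n" and n: "n \<ge> 1"
  shows "firsts \<pi> = plateaux \<pi> \<union> first_ascents \<pi>"
proof (intro equalityI subsetI)
  fix i assume i: "i \<in> firsts \<pi>"
  have le: "i \<le> 2 * n" and len: "length \<pi> = 2 * n"
    using i length_stirling_perms[OF \<pi>] by (auto simp: firsts_def)
  have "1 \<le> letter \<pi> 1"
    using letter_mem[OF \<pi>, of 1] n by simp
  then have "letter \<pi> i = letter \<pi> (i + 1) \<longrightarrow> 1 \<le> i"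
    by (cases i) (auto simp: letter_def)
  moreover have "letter \<pi> i < letter \<pi> (i + 1) \<longrightarrow> i < length \<pi>"
    by (auto simp: letter_def)
  ultimately show "i \<in> plateaux \<pi> \<union> first_ascents \<pi>"
    using i firsts_le[OF \<pi> i] by (auto simp: firsts_def plateaux_def first_ascents_def)
next
  fix i assume i: "i \<in> plateaux \<pi> \<union> first_ascents \<pi>"
  have len: "length \<pi> = 2 * n"
    by (rule length_stirling_perms[OF \<pi>])
  show "i \<in> firsts \<pi>"
  proof (cases "i \<in> plateaux \<pi>")
    case True
    then have eq: "1 \<le> i" "letter \<pi> i = letter \<pi> (i + 1)" "i \<le> 2 * n"
      using len by (auto simp: plateaux_def)
    then have "letter \<pi> i \<ge> 1"
      using letter_mem[OF \<pi>, of i] by simp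
    \<comment> \<open>A plateau at the last position would equate a positive letter with the
      boundary letter 0.\<close>
    then have "i + 1 \<le> 2 * n"
      using eq len by (auto simp: letter_def split: if_splits)
    then have "letter \<pi> j \<noteq> letter \<pi> i" if "1 \<le> j" "j < i" for j
      using stirling_between[OF \<pi>, of j i "i + 1"] that eq by auto
    then show ?thesis
      using eq len by (auto simp: firsts_def)
  next
    case False
    then show ?thesis
      using i by (auto simp: firsts_def first_ascents_def)
  qed
qed

lemma plateaux_Int_first_ascents: "plateaux \<pi> \<inter> first_ascents \<pi> = {}"
  by (auto simp: plateaux_def first_ascents_def)

lemma stirling_poly_eq:
  assumes "n \<ge> 1"
  shows "stirling_poly n = (\<Sum>\<pi>\<in>stirling_perms n. \<Prod>i\<in>firsts \<pi>. Var (gap_var \<pi> i))"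
  unfolding stirling_poly_def
proof (rule sum.cong[OF refl])
  fix \<pi> assume \<pi>: "\<pi> \<in> stirling_perms n"
  have eq: "firsts \<pi> = plateaux \<pi> \<union> first_ascents \<pi>"
    by (rule firsts_eq_plateaux_Un_first_ascents[OF \<pi> assms])
  then have "finite (plateaux \<pi>)" "finite (first_ascents \<pi>)"
    using finite_firsts[of \<pi>] by auto
  then have "(\<Prod>i\<in>firsts \<pi>. Var (gap_var \<pi> i) :: (xy_var, real) mpoly) =
      (\<Prod>i\<in>plateaux \<pi>. Var (gap_var \<pi> i)) * (\<Prod>i\<in>first_ascents \<pi>. Var (gap_var \<pi> i))"
    unfolding eq by (rule prod.union_disjoint) (rule plateaux_Int_first_ascents)
  also have "(\<Prod>i\<in>plateaux \<pi>. Var (gap_var \<pi> i) :: (xy_var, real) mpoly)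
      = (\<Prod>i\<in>plateaux \<pi>. Var (XVar (letter \<pi> i)))"
    by (rule prod.cong) (auto simp: gap_var_def plateaux_def)
  also have "(\<Prod>i\<in>first_ascents \<pi>. Var (gap_var \<pi> i) :: (xy_var, real) mpoly)
      = (\<Prod>i\<in>first_ascents \<pi>. Var (YVar (letter \<pi> (i + 1))))"
    by (rule prod.cong) (auto simp: gap_var_def first_ascents_def)
  finally show "(\<Prod>i\<in>plateaux \<pi>. Var (XVar (letter \<pi> i))) *
      (\<Prod>j\<in>first_ascents \<pi>. Var (YVar (letter \<pi> (j + 1)))) =
      (\<Prod>i\<in>firsts \<pi>. Var (gap_var \<pi> i) :: (xy_var, real) mpoly)" ..
qed

lemma gap_var_mem:
  assumes \<pi>: "\<pi> \<in> stirling_perms n" and n: "n \<ge> 1" and i: "i \<in> firsts \<pi>"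
  shows "gap_var \<pi> i \<in> XVar ` {1..n} \<union> YVar ` {1..n}"
proof -
  have len: "length \<pi> = 2 * n"
    by (rule length_stirling_perms[OF \<pi>])
  have "i \<in> plateaux \<pi> \<or> i \<in> first_ascents \<pi>"
    using firsts_eq_plateaux_Un_first_ascents[OF \<pi> n] i by blast
  then show ?thesis
  proof
    assume "i \<in> plateaux \<pi>"
    then show ?thesis
      using letter_mem[OF \<pi>, of i] len by (auto simp: plateaux_def gap_var_def)
  next
    assume "i \<in> first_ascents \<pi>"
    then show ?thesis
      using letter_mem[OF \<pi>, of "i + 1"] len by (auto simp: first_ascents_def gap_var_def)
  qed
qed


section \<open>The recurrence\<close>

text \<open>Old first occurrences survive under the increasing shift \<open>?h\<close>, since
  \<open>Suc m\<close> differs from every old letter. Of the two new positions only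
  \<open>i + 1\<close> is a first occurrence.\<close>

lemma firsts_insert_pair:
  assumes \<pi>: "\<pi> \<in> stirling_perms m" and i: "i \<le> 2 * m"
  shows "firsts (insert_pair (Suc m) \<pi> i) =
    insert (i + 1) ((\<lambda>k. if k \<le> i then k else k + 2) ` firsts \<pi>)" (is "_ = insert _ (?h ` _)")
proof -
  let ?\<sigma> = "insert_pair (Suc m) \<pi> i"
  have len: "length \<pi> = 2 * m"
    by (rule length_stirling_perms[OF \<pi>])
  have L: "letter ?\<sigma> k = (if k \<le> i then letter \<pi> k else if k \<le> i + 2 then Suc m else letter \<pi> (k - 2))" for k
    using letter_insert_pair[of i \<pi> "Suc m" k] i len by auto
  have nm: "letter \<pi> k \<noteq> Suc m" "Suc m \<noteq> letter \<pi> k" for k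
    using letter_le[OF \<pi>, of k] by auto
  have h: "?h k \<in> firsts ?\<sigma> \<longleftrightarrow> k \<in> firsts \<pi>" for k
  proof
    assume k: "?h k \<in> firsts ?\<sigma>"
    have "letter \<pi> j \<noteq> letter \<pi> k" if "1 \<le> j" "j < k" for j
    proof -
      have "1 \<le> ?h j" "?h j < ?h k"
        using that by auto
      then have "letter ?\<sigma> (?h j) \<noteq> letter ?\<sigma> (?h k)"
        using k unfolding firsts_def by blast
      then show ?thesis
        by (auto simp: L split: if_splits)
    qed
    then show "k \<in> firsts \<pi>"
      using k len i by (auto simp: firsts_def split: if_splits)
  next
    assume k: "k \<in> firsts \<pi>"
    have "letter ?\<sigma> j \<noteq> letter ?\<sigma> (?h k)" if "1 \<le> j" "j < ?h k" for j
    proof (cases "j \<in> {i + 1, i + 2}")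
      case True
      then show ?thesis
        using nm by (auto simp: L)
    next
      case False
      define j' where "j' = (if j \<le> i then j else j - 2)"
      have "1 \<le> j'" "j' < k"
        using that False by (auto simp: j'_def split: if_splits)
      then have "letter \<pi> j' \<noteq> letter \<pi> k"
        using k unfolding firsts_def by blast
      then show ?thesis
        using False by (auto simp: L j'_def split: if_splits)
    qed
    then show "?h k \<in> firsts ?\<sigma>"
      using k i len unfolding firsts_def by auto
  qed
  have "i + 1 \<in> firsts ?\<sigma>"
    using i len nm by (auto simp: firsts_def L)
  moreover have "i + 2 \<notin> firsts ?\<sigma>"
    by (auto simp: firsts_def L intro!: exI[of _ "i + 1"])
  moreover have "\<exists>k. j = ?h k" if "j \<notin> {i + 1, i + 2}" for j
    using that by (intro exI[of _ "if j \<le> i then j else j - 2"]) auto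
  ultimately show ?thesis
    using h by blast
qed

text \<open>The gap between the new copies is a plateau and gives the \<open>x\<close> factor. Gap
  \<open>i\<close> now ascends to \<open>Suc m\<close>, so its variable, if \<open>i\<close> is a
  first occurrence, becomes the new \<open>y\<close>. All other gaps after first occurrences keep
  their variables.\<close>

lemma prod_firsts_insert_pair:
  fixes z :: "xy_var \<Rightarrow> 'a::comm_monoid_mult"
  assumes \<pi>: "\<pi> \<in> stirling_perms m" and i: "i \<le> 2 * m"
  shows "(\<Prod>j\<in>firsts (insert_pair (Suc m) \<pi> i). z (gap_var (insert_pair (Suc m) \<pi> i) j)) =
    z (XVar (Suc m)) * (\<Prod>j\<in>firsts \<pi>. if j = i then z (YVar (Suc m)) else z (gap_var \<pi> j))"
proof -
  let ?\<sigma> = "insert_pair (Suc m) \<pi> i"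
  let ?h = "\<lambda>k. if k \<le> i then k else k + 2"
  have len: "length \<pi> = 2 * m"
    by (rule length_stirling_perms[OF \<pi>])
  have L: "letter ?\<sigma> k = (if k \<le> i then letter \<pi> k else if k \<le> i + 2 then Suc m else letter \<pi> (k - 2))" for k
    using letter_insert_pair[of i \<pi> "Suc m" k] i len by auto
  have nm: "letter \<pi> k \<noteq> Suc m" for k
    using letter_le[OF \<pi>, of k] by auto
  have inj: "inj_on ?h (firsts \<pi>)"
    by (auto simp: inj_on_def)
  have notin: "i + 1 \<notin> ?h ` firsts \<pi>"
    by auto
  have X: "gap_var ?\<sigma> (i + 1) = XVar (Suc m)"
    by (simp add: gap_var_def L)
  have Y: "gap_var ?\<sigma> (?h j) = (if j = i then YVar (Suc m) else gap_var \<pi> j)" for j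
    using nm by (auto simp: gap_var_def L)
  have "(\<Prod>j\<in>firsts ?\<sigma>. z (gap_var ?\<sigma> j)) =
      z (gap_var ?\<sigma> (i + 1)) * (\<Prod>j\<in>?h ` firsts \<pi>. z (gap_var ?\<sigma> j))"
    unfolding firsts_insert_pair[OF assms] by (rule prod.insert) (use notin in auto)
  also have "(\<Prod>j\<in>?h ` firsts \<pi>. z (gap_var ?\<sigma> j)) = (\<Prod>j\<in>firsts \<pi>. z (gap_var ?\<sigma> (?h j)))"
    by (simp only: prod.reindex[OF inj] o_def)
  finally show ?thesis
    unfolding X Y by (simp only: if_distrib[of z])
qed

text \<open>
  For \<open>n = 0\<close> this is the junk value \<open>z (XVar 0)\<close> rather than the empty product; the recurrence
  nevertheless yields the right value for \<open>n = 1\<close>.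
\<close>

definition stirling_eval :: "nat \<Rightarrow> (xy_var \<Rightarrow> 'a::comm_semiring_1) \<Rightarrow> 'a" where
  "stirling_eval n z = (\<Sum>\<pi>\<in>stirling_perms n. \<Prod>i\<in>firsts \<pi>. z (gap_var \<pi> i))"

text \<open>The double sum is the sum of all partial derivatives of the order \<open>m\<close> sum,
  expanded by the product rule. It collects the insertions after first occurrences; each of the
  other \<open>m\<close> gaps leaves the product unchanged.\<close>

lemma stirling_eval_Suc:
  "stirling_eval (Suc m) z = z (XVar (Suc m)) * (of_nat m * stirling_eval m z + z (YVar (Suc m)) *
     (\<Sum>\<pi>\<in>stirling_perms m. \<Sum>i\<in>firsts \<pi>. \<Prod>j\<in>firsts \<pi> - {i}. z (gap_var \<pi> j)))"
proof -
  let ?x = "z (XVar (Suc m))" and ?y = "z (YVar (Suc m))"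
  let ?w = "\<lambda>\<pi> i. \<Prod>j\<in>firsts \<pi>. if j = i then ?y else z (gap_var \<pi> j)"
  have "stirling_eval (Suc m) z =
      (\<Sum>(\<pi>, i)\<in>stirling_perms m \<times> {..2 * m}.
        \<Prod>j\<in>firsts (insert_pair (Suc m) \<pi> i). z (gap_var (insert_pair (Suc m) \<pi> i) j))"
    unfolding stirling_eval_def
    by (subst sum.reindex_bij_betw[OF bij_betw_insert_pair, symmetric]) (simp add: case_prod_unfold)
  also have "\<dots> = (\<Sum>(\<pi>, i)\<in>stirling_perms m \<times> {..2 * m}. ?x * ?w \<pi> i)"
    by (rule sum.cong) (auto simp: prod_firsts_insert_pair)
  also have "\<dots> = ?x * (\<Sum>\<pi>\<in>stirling_perms m. \<Sum>i\<le>2 * m. ?w \<pi> i)"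
    by (simp add: sum.cartesian_product[symmetric] sum_distrib_left)
  also have "(\<Sum>\<pi>\<in>stirling_perms m. \<Sum>i\<le>2 * m. ?w \<pi> i) =
      (\<Sum>\<pi>\<in>stirling_perms m. of_nat m * (\<Prod>i\<in>firsts \<pi>. z (gap_var \<pi> i)) +
        ?y * (\<Sum>i\<in>firsts \<pi>. \<Prod>j\<in>firsts \<pi> - {i}. z (gap_var \<pi> j)))"
  proof (rule sum.cong[OF refl])
    fix \<pi> assume \<pi>: "\<pi> \<in> stirling_perms m"
    have sub: "firsts \<pi> \<subseteq> {..2 * m}"
      using length_stirling_perms[OF \<pi>] by (auto simp: firsts_def)
    have "(\<Sum>i\<le>2 * m. ?w \<pi> i) = (\<Sum>i\<in>{..2 * m} - firsts \<pi>. ?w \<pi> i) + (\<Sum>i\<in>firsts \<pi>. ?w \<pi> i)"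
      by (rule sum.subset_diff[OF sub]) simp
    also have "(\<Sum>i\<in>{..2 * m} - firsts \<pi>. ?w \<pi> i) =
        (\<Sum>i\<in>{..2 * m} - firsts \<pi>. \<Prod>i\<in>firsts \<pi>. z (gap_var \<pi> i))"
      by (intro sum.cong prod.cong) auto
    also have "\<dots> = of_nat m * (\<Prod>i\<in>firsts \<pi>. z (gap_var \<pi> i))"
      by (simp add: card_not_firsts[OF \<pi>])
    also have "(\<Sum>i\<in>firsts \<pi>. ?w \<pi> i) = (\<Sum>i\<in>firsts \<pi>. ?y * (\<Prod>j\<in>firsts \<pi> - {i}. z (gap_var \<pi> j)))"
    proof (rule sum.cong[OF refl])
      fix i assume "i \<in> firsts \<pi>"
      then have "?w \<pi> i = ?y * (\<Prod>j\<in>firsts \<pi> - {i}. if j = i then ?y else z (gap_var \<pi> j))"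
        by (subst prod.remove[of _ i]) auto
      also have "(\<Prod>j\<in>firsts \<pi> - {i}. if j = i then ?y else z (gap_var \<pi> j)) =
          (\<Prod>j\<in>firsts \<pi> - {i}. z (gap_var \<pi> j))"
        by (rule prod.cong) auto
      finally show "?w \<pi> i = ?y * (\<Prod>j\<in>firsts \<pi> - {i}. z (gap_var \<pi> j))" .
    qed
    finally show "(\<Sum>i\<le>2 * m. ?w \<pi> i) = of_nat m * (\<Prod>i\<in>firsts \<pi>. z (gap_var \<pi> i)) +
        ?y * (\<Sum>i\<in>firsts \<pi>. \<Prod>j\<in>firsts \<pi> - {i}. z (gap_var \<pi> j))"
      by (simp add: sum_distrib_left)
  qed
  finally show ?thesis
    by (simp add: stirling_eval_def sum.distrib sum_distrib_left)
qed

section \<open>Nonvanishing by induction on the order\<close>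

lemma stirling_perms_0: "stirling_perms 0 = {[]}"
proof
  show "stirling_perms 0 \<subseteq> {[]}"
    using length_stirling_perms[of _ 0] by auto
  show "{[]} \<subseteq> stirling_perms 0"
    by (simp add: stirling_perms_def)
qed

lemma firsts_Nil: "firsts [] = {0}"
  by (auto simp: firsts_def)

text \<open>The induction starts at 1 because the coefficient \<open>m\<close> of the recurrence
  must be positive in the logarithmic derivative argument.\<close>

lemma stirling_eval_nonzero:
  fixes z :: "xy_var \<Rightarrow> complex"
  assumes "n \<ge> 1" "\<And>v. v \<in> XVar ` {1..n} \<union> YVar ` {1..n} \<Longrightarrow> Im (z v) > 0"
  shows "stirling_eval n z \<noteq> 0"
  using assms
proof (induction n arbitrary: z rule: nat_induct_at_least)
  case base
  then have "z (XVar 1) \<noteq> 0" "z (YVar 1) \<noteq> 0"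
    by force+
  then show ?case
    \<comment> \<open>For \<open>m = 0\<close> the junk value is multiplied by 0, and the derivative
      sum is one empty product, so the result is \<open>z (XVar 1) * z (YVar 1)\<close>.\<close>
    using stirling_eval_Suc[of 0 z] by (simp add: stirling_perms_0 firsts_Nil)
next
  case (Suc m)
  \<comment> \<open>Shifting all variables by a common \<open>t\<close> gives a univariate
    polynomial whose derivative at 0 is the sum of the partial derivatives at
    \<open>z\<close>.\<close>
  define p where "p = (\<Sum>\<pi>\<in>stirling_perms m. \<Prod>i\<in>firsts \<pi>. [:z (gap_var \<pi> i), 1:])"
  have p: "poly p t = stirling_eval m (\<lambda>v. z v + t)" for t
    by (simp add: p_def stirling_eval_def poly_sum poly_prod)
  \<comment> \<open>The shift keeps all variables in the open upper half-plane, so the induction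
    hypothesis applies at the shifted point.\<close>
  have "poly p t \<noteq> 0" if "Im t \<ge> 0" for t
    unfolding p using that Suc.prems by (intro Suc.IH) (force intro: add_pos_nonneg)
  moreover have "Im (z (YVar (Suc m))) > 0"
    using Suc.prems by simp
  ultimately have "of_real (real m) * poly p 0 + z (YVar (Suc m)) * poly (pderiv p) 0 \<noteq> 0"
    using Suc.hyps by (intro add_mult_log_deriv_nonzero) auto
  moreover have "poly (pderiv p) 0 =
      (\<Sum>\<pi>\<in>stirling_perms m. \<Sum>i\<in>firsts \<pi>. \<Prod>j\<in>firsts \<pi> - {i}. z (gap_var \<pi> j))"
    by (simp add: p_def higher_pderiv_sum[of 1, simplified] pderiv_prod pderiv_pCons poly_sum poly_prod)
  moreover have "z (XVar (Suc m)) \<noteq> 0"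
    using Suc.prems[of "XVar (Suc m)"] by auto
  ultimately show ?case
    by (simp add: stirling_eval_Suc p)
qed

theorem theorem15:
  fixes n :: nat
  assumes "n \<ge> 1"
  shows "real_stable (XVar ` {1..n} \<union> YVar ` {1..n}) (stirling_poly n)"
proof -
  have "stirling_poly n \<in> polys_over (XVar ` {1..n} \<union> YVar ` {1..n})"
    unfolding stirling_poly_eq[OF assms]
    by (rule polys_over_sum, rule polys_over_prod_Var, rule gap_var_mem[OF _ assms])
  moreover have "ceval z (stirling_poly n) = stirling_eval n z" for z
    by (simp add: stirling_poly_eq[OF assms] ceval_sum ceval_prod_Var stirling_eval_def)
  ultimately show ?thesis
    unfolding real_stable_def using stirling_eval_nonzero[OF assms] by simp
qed

end
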